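(* Let $A$ be a $2\times 2$ real matrix. Then $A$ has the $\mathbf{Q}$-property if and only if one of the following holds: (i) $A$ has one of the following sign patterns: $$\begin{bmatrix}+&*\\ \oplus&+\end{bmatrix},\quad \begin{bmatrix}+&\oplus\\ *&+\end{bmatrix},\quad \begin{bmatrix}0&+\\ -&+\end{bmatrix},\quad \begin{bmatrix}+&-\\ +&0\end{bmatrix};$$ (ii) $\det A>0$ and $A$ has one of the following sign patterns: $$\begin{bmatrix}+&-\\ -&+\end{bmatrix},\quad \begin{bmatrix}-&+\\ -&+\end{bmatrix},\quad \begin{bmatrix}+&-\\ +&-\end{bmatrix};$$ (iii) $\det A<0$ and $A$ has the sign pattern $$\begin{bmatrix}-&+\\ +&-\end{bmatrix}.$$
   Context: In a sign pattern, $+$ denotes a positive entry, $-$ a negative entry, $\oplus$ a nonnegative entry, $0$ a zero entry, and $*$ an arbitrary real entry. For $A\in\mathbb{R}^{n\times n}$ and $q\in\mathbb{R}^n$, $\mathrm{LCP}(A,q)$ is the problem of finding $x\in\mathbb{R}^n$ with $x\ge 0$, $Ax+q\ge 0$ and $x^\top(Ax+q)=0$ (componentwise inequalities). $A$ has the $\mathbf{Q}$-property if $\mathrm{LCP}(A,q)$ has a solution for every $q\in\mathbb{R}^n$. *)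

theory Defs
  imports "HOL-Analysis.Analysis"
begin

text \<open>The order on \<^typ>\<open>real ^ 'n\<close> is the componentwise one.\<close>

definition solves_LCP :: "real ^ 'n ^ 'n \<Rightarrow> real ^ 'n \<Rightarrow> real ^ 'n \<Rightarrow> bool" where
  "solves_LCP A q x \<longleftrightarrow> 0 \<le> x \<and> 0 \<le> A *v x + q \<and> x \<bullet> (A *v x + q) = 0"

definition Q_property :: "real ^ 'n ^ 'n \<Rightarrow> bool" where
  "Q_property A \<longleftrightarrow> (\<forall>q. \<exists>x. solves_LCP A q x)"

datatype sign_entry = Pos | Neg | Nonneg | Zero | Arb

fun matches_sign :: "sign_entry \<Rightarrow> real \<Rightarrow> bool" where
  "matches_sign Pos a \<longleftrightarrow> a > 0"
| "matches_sign Neg a \<longleftrightarrow> a < 0"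
| "matches_sign Nonneg a \<longleftrightarrow> a \<ge> 0"
| "matches_sign Zero a \<longleftrightarrow> a = 0"
| "matches_sign Arb a \<longleftrightarrow> True"

text \<open>The two pairs are the first and the second row of the pattern; \<open>A $ i $ j\<close> is
  the entry of \<open>A\<close> in row \<open>i\<close> and column \<open>j\<close>.\<close>

fun has_sign_pattern ::
    "real ^ 2 ^ 2 \<Rightarrow> sign_entry \<times> sign_entry \<Rightarrow> sign_entry \<times> sign_entry \<Rightarrow> bool" where
  "has_sign_pattern A (s11, s12) (s21, s22) \<longleftrightarrow>
     matches_sign s11 (A $ 1 $ 1) \<and> matches_sign s12 (A $ 1 $ 2) \<and>
     matches_sign s21 (A $ 2 $ 1) \<and> matches_sign s22 (A $ 2 $ 2)"

end

theory Submission
  imports Defs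
begin

text \<open>In dimension two a solution of the LCP can be sought on the four complementary faces
  \<open>x = y = 0\<close>; \<open>y = 0\<close> and first slack \<open>0\<close>; \<open>x = 0\<close> and second slack \<open>0\<close>; both slacks \<open>0\<close>.
  Each face is solvable on an explicit cone of right-hand sides, and for each of the listed
  patterns the four cones cover the plane. Conversely the right-hand sides \<open>(-1,1)\<close>, \<open>(1,-1)\<close>
  and \<open>(-1,-1)\<close> suffice to exclude every other matrix. Exchanging the two coordinates halves
  the number of cases.\<close>

section \<open>The problem in coordinates\<close>

definition LCP2 :: "real \<Rightarrow> real \<Rightarrow> real \<Rightarrow> real \<Rightarrow> real \<Rightarrow> real \<Rightarrow> real \<Rightarrow> real \<Rightarrow> bool" where
  "LCP2 a b c d p q x y \<longleftrightarrow>
     0 \<le> x \<and> 0 \<le> y \<and> 0 \<le> a * x + b * y + p \<and> 0 \<le> c * x + d * y + q \<and>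
     x * (a * x + b * y + p) = 0 \<and> y * (c * x + d * y + q) = 0"

definition Q2 :: "real \<Rightarrow> real \<Rightarrow> real \<Rightarrow> real \<Rightarrow> bool" where
  "Q2 a b c d \<longleftrightarrow> (\<forall>p q. \<exists>x y. LCP2 a b c d p q x y)"

text \<open>The inner product is a sum of two nonnegative products, so it vanishes only if each
  product does.\<close>

lemma solves_LCP_iff_LCP2:
  fixes A :: "real ^ 2 ^ 2"
  shows "solves_LCP A v z \<longleftrightarrow>
    LCP2 (A $ 1 $ 1) (A $ 1 $ 2) (A $ 2 $ 1) (A $ 2 $ 2) (v $ 1) (v $ 2) (z $ 1) (z $ 2)"
  by (auto simp: solves_LCP_def LCP2_def less_eq_vec_def forall_2 inner_vec_def sum_2
      matrix_vector_mult_def add_nonneg_eq_0_iff)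

lemma Q_property_iff_Q2:
  fixes A :: "real ^ 2 ^ 2"
  shows "Q_property A \<longleftrightarrow> Q2 (A $ 1 $ 1) (A $ 1 $ 2) (A $ 2 $ 1) (A $ 2 $ 2)"
proof
  assume Q: "Q_property A"
  show "Q2 (A $ 1 $ 1) (A $ 1 $ 2) (A $ 2 $ 1) (A $ 2 $ 2)"
    unfolding Q2_def
  proof (intro allI)
    fix p q
    obtain z where "solves_LCP A (vector [p, q]) z"
      using Q unfolding Q_property_def by blast
    then show "\<exists>x y. LCP2 (A $ 1 $ 1) (A $ 1 $ 2) (A $ 2 $ 1) (A $ 2 $ 2) p q x y"
      by (auto simp: solves_LCP_iff_LCP2)
  qed
next
  assume Q: "Q2 (A $ 1 $ 1) (A $ 1 $ 2) (A $ 2 $ 1) (A $ 2 $ 2)"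
  show "Q_property A"
    unfolding Q_property_def
  proof
    fix v :: "real ^ 2"
    obtain x y where
      "LCP2 (A $ 1 $ 1) (A $ 1 $ 2) (A $ 2 $ 1) (A $ 2 $ 2) (v $ 1) (v $ 2) x y"
      using Q unfolding Q2_def by blast
    then have "solves_LCP A v (vector [x, y])"
      by (simp add: solves_LCP_iff_LCP2)
    then show "\<exists>z. solves_LCP A v z" ..
  qed
qed

section \<open>Symmetry and solvability on the four complementary faces\<close>

lemma LCP2_swap: "LCP2 a b c d p q x y \<longleftrightarrow> LCP2 d c b a q p y x"
  by (auto simp: LCP2_def algebra_simps)

lemma Q2_swap: "Q2 a b c d \<longleftrightarrow> Q2 d c b a"
  unfolding Q2_def using LCP2_swap by blast

lemma LCP2_zero:
  assumes "0 \<le> p" "0 \<le> q"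
  shows "\<exists>x y. LCP2 a b c d p q x y"
  by (intro exI[of _ 0]) (simp add: LCP2_def assms)

text \<open>On the face \<open>y = 0\<close> with first slack \<open>0\<close> the only candidate is
  \<open>x = - p / a\<close>. The last two assumptions are \<open>x \<ge> 0\<close> and
  nonnegativity of the second slack, cleared of the denominator.\<close>

lemma LCP2_first:
  assumes "0 < a" "p \<le> 0" "c * p \<le> a * q"
  shows "\<exists>x y. LCP2 a b c d p q x y"
proof -
  have "LCP2 a b c d p q (- p / a) 0"
    using assms by (simp add: LCP2_def field_simps)
  then show ?thesis by blast
qed

lemma LCP2_first_neg:
  assumes "a < 0" "0 \<le> p" "a * q \<le> c * p"
  shows "\<exists>x y. LCP2 a b c d p q x y"
proof -
  have "LCP2 a b c d p q (- p / a) 0"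
    using assms by (simp add: LCP2_def field_simps)
  then show ?thesis by blast
qed

lemma LCP2_second:
  assumes "0 < d" "q \<le> 0" "b * q \<le> d * p"
  shows "\<exists>x y. LCP2 a b c d p q x y"
  using LCP2_first[OF assms] LCP2_swap by blast

lemma LCP2_second_neg:
  assumes "d < 0" "0 \<le> q" "d * p \<le> b * q"
  shows "\<exists>x y. LCP2 a b c d p q x y"
  using LCP2_first_neg[OF assms] LCP2_swap by blast

text \<open>Cramer's rule for the system in which both slacks vanish.\<close>

lemma LCP2_interior:
  assumes "0 \<le> (b * q - d * p) / (a * d - b * c)" "0 \<le> (c * p - a * q) / (a * d - b * c)"
    and det: "a * d - b * c \<noteq> 0"
  shows "\<exists>x y. LCP2 a b c d p q x y"
proof -
  let ?x = "(b * q - d * p) / (a * d - b * c)" and ?y = "(c * p - a * q) / (a * d - b * c)"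
  have "a * ?x + b * ?y + p = 0" "c * ?x + d * ?y + q = 0"
    using det by (simp_all add: divide_simps) (simp_all add: algebra_simps)
  with assms have "LCP2 a b c d p q ?x ?y"
    unfolding LCP2_def by simp
  then show ?thesis by blast
qed

lemma LCP2_interior_pos:
  assumes "d * p \<le> b * q" "a * q \<le> c * p" "b * c < a * d"
  shows "\<exists>x y. LCP2 a b c d p q x y"
  by (rule LCP2_interior) (use assms in \<open>simp_all add: zero_le_divide_iff\<close>)

lemma LCP2_interior_neg:
  assumes "b * q \<le> d * p" "c * p \<le> a * q" "a * d < b * c"
  shows "\<exists>x y. LCP2 a b c d p q x y"
  by (rule LCP2_interior) (use assms in \<open>simp_all add: zero_le_divide_iff\<close>)

section \<open>Sufficiency: the cones cover the plane\<close>

lemma Q2_pos_diagonal: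
  assumes "0 < a" "0 < d" "0 \<le> c"
  shows "Q2 a b c d"
  unfolding Q2_def
proof (intro allI)
  fix p q :: real
  \<comment> \<open>The last three alternatives split \<open>q < 0\<close> by the signs of the two
    numerators in Cramer's rule.\<close>
  consider "0 \<le> p" "0 \<le> q" | "p < 0" "0 \<le> q" | "q < 0" "b * q \<le> d * p"
    | "q < 0" "d * p < b * q" "c * p \<le> a * q" | "q < 0" "d * p < b * q" "a * q < c * p"
    by linarith
  then show "\<exists>x y. LCP2 a b c d p q x y"
  proof cases
    case 1
    then show ?thesis by (rule LCP2_zero)
  next
    case 2
    then have "c * p \<le> 0" "0 \<le> a * q"
      using assms by (simp_all add: mult_nonneg_nonpos)
    then show ?thesis using 2 assms by (intro LCP2_first) linarith+
  next
    case 3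
    then show ?thesis using assms by (intro LCP2_second) auto
  next
    case 4
    then have "c * p < 0"
      using assms mult_pos_neg[of a q] by linarith
    then have "p < 0"
      using assms by (simp add: mult_less_0_iff)
    then show ?thesis using 4 assms by (intro LCP2_first) auto
  next
    case 5
    \<comment> \<open>The hypotheses leave the sign of the determinant open. Eliminating
      \<open>p\<close> from the two inequalities of this case shows that it is positive.\<close>
    have "c * (d * p) \<le> c * (b * q)" "d * (a * q) < d * (c * p)"
      using 5 assms by (simp_all add: mult_left_mono)
    then have "q * (a * d - b * c) < 0"
      by (simp add: algebra_simps)
    then have "b * c < a * d"
      using 5 by (simp add: mult_less_0_iff)
    then show ?thesis using 5 by (intro LCP2_interior_pos) auto
  qed
qed

lemma Q2_pos_diagonal_pos_det:
  assumes "0 < a" "0 < d" "b < 0" "c < 0" "b * c < a * d"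
  shows "Q2 a b c d"
  unfolding Q2_def
proof (intro allI)
  fix p q :: real
  consider "0 \<le> p" "0 \<le> q" | "q \<le> 0" "b * q \<le> d * p" | "p \<le> 0" "c * p \<le> a * q"
    | "d * p \<le> b * q" "a * q \<le> c * p" | "0 < p" "d * p < b * q" "c * p < a * q"
    | "0 < q" "b * q < d * p" "a * q < c * p"
    by linarith
  then show "\<exists>x y. LCP2 a b c d p q x y"
  proof cases
    case 1
    then show ?thesis by (rule LCP2_zero)
  next
    case 2
    then show ?thesis using assms by (intro LCP2_second)
  next
    case 3
    then show ?thesis using assms by (intro LCP2_first)
  next
    case 4
    then show ?thesis using assms by (intro LCP2_interior_pos)
  next
    case 5
    \<comment> \<open>This region is empty: adding the two inequalities cancels
      \<open>a * b * q\<close> and makes \<open>p\<close> times the determinant negative, although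
      both are positive.\<close>
    have "a * (d * p) < a * (b * q)" "b * (a * q) < b * (c * p)"
      using 5 assms by simp_all
    then have "p * (a * d - b * c) < 0"
      by (simp add: algebra_simps)
    then show ?thesis using 5 assms by (simp add: mult_less_0_iff)
  next
    case 6
    have "d * (a * q) < d * (c * p)" "c * (d * p) < c * (b * q)"
      using 6 assms by simp_all
    then have "q * (a * d - b * c) < 0"
      by (simp add: algebra_simps)
    then show ?thesis using 6 assms by (simp add: mult_less_0_iff)
  qed
qed

text \<open>Treats \<open>a = 0\<close> and \<open>a < 0\<close> together; for \<open>a = 0\<close>
  the determinant condition follows from the signs of \<open>b\<close> and \<open>c\<close>.\<close>

lemma Q2_nonpos_pos_det:
  assumes "a \<le> 0" "0 < b" "c < 0" "0 < d" "b * c < a * d"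
  shows "Q2 a b c d"
  unfolding Q2_def
proof (intro allI)
  fix p q :: real
  consider "0 \<le> p" "0 \<le> q" | "q \<le> 0" "b * q \<le> d * p" | "p < 0" "0 \<le> q"
    | "q < 0" "d * p < b * q" "a * q \<le> c * p" | "q < 0" "d * p < b * q" "c * p < a * q"
    by linarith
  then show "\<exists>x y. LCP2 a b c d p q x y"
  proof cases
    case 1
    then show ?thesis by (rule LCP2_zero)
  next
    case 2
    then show ?thesis using assms by (intro LCP2_second)
  next
    case 3
    then have "d * p \<le> 0" "0 \<le> b * q" "a * q \<le> 0" "0 \<le> c * p"
      using assms by (simp_all add: mult_le_0_iff zero_le_mult_iff)
    then show ?thesis using assms by (intro LCP2_interior_pos) linarith+
  next
    case 4
    then show ?thesis using assms by (intro LCP2_interior_pos) auto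
  next
    case 5
    have "d * (c * p) < d * (a * q)" "c * (b * q) < c * (d * p)"
      using 5 assms by simp_all
    then have "0 < q * (a * d - b * c)"
      by (simp add: algebra_simps)
    then show ?thesis using 5 assms by (simp add: zero_less_mult_iff)
  qed
qed

text \<open>Cases 5 and 6 are empty: eliminating \<open>q\<close>, respectively \<open>p\<close>,
  makes the nonnegative remaining coordinate times the negative determinant strictly
  positive.\<close>

lemma Q2_neg_diagonal:
  assumes "a < 0" "0 < b" "0 < c" "d < 0" "a * d < b * c"
  shows "Q2 a b c d"
  unfolding Q2_def
proof (intro allI)
  fix p q :: real
  consider "0 \<le> p" "a * q \<le> c * p" | "0 \<le> q" "d * p \<le> b * q"
    | "p < 0" "q < 0" | "b * q \<le> d * p" "c * p \<le> a * q"
    | "0 \<le> p" "d * p < b * q" "c * p < a * q" | "0 \<le> q" "b * q < d * p" "a * q < c * p"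
    by linarith
  then show "\<exists>x y. LCP2 a b c d p q x y"
  proof cases
    case 1
    then show ?thesis using assms by (intro LCP2_first_neg)
  next
    case 2
    then show ?thesis using assms by (intro LCP2_second_neg)
  next
    case 3
    then have "b * q \<le> 0" "0 \<le> d * p" "c * p \<le> 0" "0 \<le> a * q"
      using assms by (simp_all add: mult_le_0_iff zero_le_mult_iff)
    then show ?thesis using assms by (intro LCP2_interior_neg) linarith+
  next
    case 4
    then show ?thesis using assms by (intro LCP2_interior_neg)
  next
    case 5
    have "a * (b * q) < a * (d * p)" "b * (c * p) < b * (a * q)"
      using 5 assms by simp_all
    then have "0 < p * (a * d - b * c)"
      by (simp add: algebra_simps)
    then show ?thesis using 5 assms by (simp add: zero_less_mult_iff)
  next
    case 6
    have "c * (b * q) < c * (d * p)" "d * (c * p) < d * (a * q)"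
      using 6 assms by simp_all
    then have "0 < q * (a * d - b * c)"
      by (simp add: algebra_simps)
    then show ?thesis using 6 assms by (simp add: zero_less_mult_iff)
  qed
qed

section \<open>Necessity: testing three right-hand sides\<close>

lemma Q2_nonpos_imp:
  assumes "Q2 a b c d" "a \<le> 0"
  shows "0 < b" "c < 0 \<or> d < 0" "0 \<le> d \<Longrightarrow> b * c < a * d"
proof -
  obtain x y where L: "LCP2 a b c d (-1) 1 x y"
    using assms(1) unfolding Q2_def by blast
  then have nonneg: "0 \<le> x" "0 \<le> y" and row1: "1 \<le> a * x + b * y"
    by (simp_all add: LCP2_def)
  have "a * x \<le> 0"
    using nonneg assms(2) by (simp add: mult_nonpos_nonneg)
  with row1 have "0 < b * y" by linarith
  with nonneg show "0 < b"
    by (simp add: zero_less_mult_iff)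
  \<comment> \<open>Positivity of \<open>y\<close> turns the second row into an equation by
    complementarity. Its right-hand side \<open>-1\<close> forces a negative coefficient.\<close>
  have "y \<noteq> 0"
    using \<open>0 < b * y\<close> by auto
  with L have row2: "c * x + d * y = -1"
    by (simp add: LCP2_def)
  show "c < 0 \<or> d < 0"
  proof (rule ccontr)
    assume "\<not> (c < 0 \<or> d < 0)"
    then have "0 \<le> c * x" "0 \<le> d * y"
      using nonneg by simp_all
    with row2 show False by linarith
  qed
  assume "0 \<le> d"
  \<comment> \<open>Eliminating \<open>y\<close> from the rows expresses the determinant, up to the
    factor \<open>x \<ge> 0\<close>, through the known row values.\<close>
  have "x * (a * d - b * c) = d * (a * x + b * y) - b * (c * x + d * y)"
    by (simp add: algebra_simps)
  also have "\<dots> = d * (a * x + b * y) + b"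
    by (simp add: row2)
  also have "\<dots> > 0"
    using row1 \<open>0 \<le> d\<close> \<open>0 < b\<close> by (intro add_nonneg_pos) auto
  finally show "b * c < a * d"
    using nonneg by (simp add: zero_less_mult_iff)
qed

text \<open>For the right-hand side \<open>(-1,-1)\<close> both rows are at least \<open>1\<close>.
  Weighting them with the positive numbers \<open>d\<close> and \<open>- b\<close> eliminates
  \<open>y\<close> and bounds \<open>x\<close> times the determinant below by
  \<open>d - b > 0\<close>.\<close>

lemma Q2_neg_off_diagonal_imp:
  assumes "Q2 a b c d" "0 < a" "0 < d" "b < 0" "c < 0"
  shows "b * c < a * d"
proof -
  obtain x y where "LCP2 a b c d (-1) (-1) x y"
    using assms(1) unfolding Q2_def by blast
  then have nonneg: "0 \<le> x" "0 \<le> y" and rows: "1 \<le> a * x + b * y" "1 \<le> c * x + d * y"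
    by (simp_all add: LCP2_def)
  have "b * (c * x + d * y) \<le> b" "d \<le> d * (a * x + b * y)"
    using rows assms by simp_all
  moreover have "x * (a * d - b * c) = d * (a * x + b * y) - b * (c * x + d * y)"
    by (simp add: algebra_simps)
  ultimately have "0 < x * (a * d - b * c)"
    using assms by linarith
  then show ?thesis
    using nonneg by (simp add: zero_less_mult_iff)
qed

text \<open>The signs come from the previous test and its mirror image. For \<open>(-1,-1)\<close>
  neither coordinate can vanish, so both rows equal \<open>1\<close> and \<open>x\<close> times the
  determinant is \<open>d - b < 0\<close>.\<close>

lemma Q2_nonpos_diagonal_imp:
  assumes "Q2 a b c d" "a \<le> 0" "d \<le> 0"
  shows "a < 0" "d < 0" "0 < b" "0 < c" "a * d < b * c"
proof -
  have Q': "Q2 d c b a"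
    using assms(1) Q2_swap by blast
  show b: "0 < b" and c: "0 < c"
    using Q2_nonpos_imp(1)[OF assms(1,2)] Q2_nonpos_imp(1)[OF Q' assms(3)] by auto
  show "a < 0" "d < 0"
    using Q2_nonpos_imp(2)[OF assms(1,2)] Q2_nonpos_imp(2)[OF Q' assms(3)] b c by auto
  obtain x y where L: "LCP2 a b c d (-1) (-1) x y"
    using assms(1) unfolding Q2_def by blast
  then have nonneg: "0 \<le> x" "0 \<le> y" and rows: "1 \<le> a * x + b * y" "1 \<le> c * x + d * y"
    by (simp_all add: LCP2_def)
  have "a * x \<le> 0" "d * y \<le> 0"
    using nonneg assms by (simp_all add: mult_nonpos_nonneg)
  with rows have "y \<noteq> 0" "x \<noteq> 0" by auto
  with L have rows: "a * x + b * y = 1" "c * x + d * y = 1"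
    by (simp_all add: LCP2_def)
  have "x * (a * d - b * c) = d * (a * x + b * y) - b * (c * x + d * y)"
    by (simp add: algebra_simps)
  also have "\<dots> < 0"
    using \<open>d < 0\<close> b by (simp add: rows)
  finally show "a * d < b * c"
    using nonneg by (simp add: mult_less_0_iff)
qed

theorem theorem9p1:
  fixes A :: "real ^ 2 ^ 2"
  shows "Q_property A \<longleftrightarrow>
    (has_sign_pattern A (Pos, Arb) (Nonneg, Pos) \<or>
     has_sign_pattern A (Pos, Nonneg) (Arb, Pos) \<or>
     has_sign_pattern A (Zero, Pos) (Neg, Pos) \<or>
     has_sign_pattern A (Pos, Neg) (Pos, Zero)) \<or>
    (det A > 0 \<and>
     (has_sign_pattern A (Pos, Neg) (Neg, Pos) \<or>
      has_sign_pattern A (Neg, Pos) (Neg, Pos) \<or>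
      has_sign_pattern A (Pos, Neg) (Pos, Neg))) \<or>
    (det A < 0 \<and> has_sign_pattern A (Neg, Pos) (Pos, Neg))"
  (is "_ \<longleftrightarrow> ?R")
proof -
  define a b c d where "a = A $ 1 $ 1" "b = A $ 1 $ 2" "c = A $ 2 $ 1" "d = A $ 2 $ 2"
  note abcd = this
  have R: "?R \<longleftrightarrow> 0 < a \<and> 0 < d \<and> (0 \<le> b \<or> 0 \<le> c) \<or>
      0 < a \<and> 0 < d \<and> b < 0 \<and> c < 0 \<and> b * c < a * d \<or>
      a = 0 \<and> 0 < b \<and> c < 0 \<and> 0 < d \<or> 0 < a \<and> b < 0 \<and> 0 < c \<and> d = 0 \<or>
      a < 0 \<and> 0 < b \<and> c < 0 \<and> 0 < d \<and> b * c < a * d \<or>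
      0 < a \<and> b < 0 \<and> 0 < c \<and> d < 0 \<and> b * c < a * d \<or>
      a < 0 \<and> 0 < b \<and> 0 < c \<and> d < 0 \<and> a * d < b * c" (is "_ \<longleftrightarrow> ?S")
    by (auto simp: abcd det_2)
  have "Q2 a b c d \<longleftrightarrow> ?S"
  proof
    assume Q: "Q2 a b c d"
    then have Q': "Q2 d c b a"
      using Q2_swap by blast
    \<comment> \<open>The signs of the diagonal decide which test applies; the third case is the
      second with the coordinates exchanged.\<close>
    consider "0 < a" "0 < d" | "a \<le> 0" "0 < d" | "0 < a" "d \<le> 0" | "a \<le> 0" "d \<le> 0"
      by linarith
    then show ?S
    proof cases
      case 1
      then show ?thesis using Q2_neg_off_diagonal_imp[OF Q] by force
    next
      case 2
      then show ?thesis using Q2_nonpos_imp[OF Q] by force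
    next
      case 3
      then show ?thesis using Q2_nonpos_imp[OF Q'] by (force simp: mult.commute)
    next
      case 4
      then show ?thesis using Q2_nonpos_diagonal_imp[OF Q] by force
    qed
  next
    assume ?S
    \<comment> \<open>Instantiation follows the order in which variables occur in the assumptions:
      \<open>[of a d c b]\<close> is the lemma as stated, and \<open>[of d a b c]\<close> concerns
      the mirrored \<open>Q2 d c b a\<close>.\<close>
    then show "Q2 a b c d"
      using Q2_pos_diagonal[of a d c b] Q2_pos_diagonal[of d a b c]
        Q2_pos_diagonal_pos_det[of a d b c] Q2_nonpos_pos_det[of a b c d]
        Q2_nonpos_pos_det[of d c b a] Q2_neg_diagonal[of a b c d] Q2_swap[of a b c d]
      by (auto simp: mult.commute mult_pos_neg mult_neg_pos)
  qed
  then show ?thesis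
    unfolding R by (simp add: Q_property_iff_Q2 abcd)
qed

end
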